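(* Let $b:\mathbb R^d\to\mathbb R^d$ be an arbitrary continuous vector field, $h>0$, and let the Markov chain $X=(X_n)_{n\in\mathbb N}$ on $\mathbb R^d$ satisfy $$X_{k+1}=X_k+hb(X_k)+Z^{(h)}_{k+1},\qquad k\in\mathbb N,$$ where $(Z_k^{(h)})_{k\in\mathbb N}$ is an i.i.d. sequence in $\mathbb R^d$ with mean zero and density $p_{\alpha,h}$ satisfying, for some $\alpha\in(1,2)$, $$0<\liminf_{r\to\infty}r^\alpha\int_{\{|x|>r\}}p_{\alpha,h}(x)\,\mathrm dx\le\limsup_{r\to\infty}r^\alpha\int_{\{|x|>r\}}p_{\alpha,h}(x)\,\mathrm dx<\infty.$$ Then the following hold. (a) Assume $|b(x)|\le C(|x|+1)$ for all $x\in\mathbb R^d$ and some constant $C>0$. If $0<h<1/(2C)$ and the chain $X$ admits an invariant distribution $\pi_h$, then for any $\varepsilon>0$ there exists a constant $C_{\pi,h}\in(0,\infty)$ satisfying $$\pi_h(\{y\in\mathbb R^d:|y|>r\})\ge C_{\pi,h}\,r^{-\alpha-\varepsilon}\qquad\text{for all } r\in[1,\infty).$$ (b) If $\liminf_{|x|\to\infty}|b(x)|/|x|=\infty$, then the chain $X$ is transient: $\mathbb P_x\big(\lim_{n\to\infty}|X_n|=\infty\big)=1$ for all $x\in\mathbb R^d$.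
   Context: $\mathbb N=\{0,1,\dots\}$; $|\cdot|$ is the Euclidean norm on $\mathbb R^d$; $\mathbb P_x$ is the law of the chain started at $X_0=x$. The paper further assumes that, as a family in $h$, $p_{\alpha,h}$ converges weakly to the delta measure at the origin as $h\to0$. *)

theory Defs
  imports "HOL-Probability.Probability"
begin

text \<open>
  The chain driven by the noise \<open>Z\<close> and started at the point \<open>x\<close>. Over a probability space
  \<open>M\<close> carrying \<open>Z\<close>, the law \<open>\<P>\<^sub>x\<close> is the distribution of \<open>em_chain b h Z x\<close> under \<open>M\<close>. The
  variable \<open>Z 0\<close> is never used.
\<close>

primrec em_chain ::
    "('a::euclidean_space \<Rightarrow> 'a) \<Rightarrow> real \<Rightarrow> (nat \<Rightarrow> 'w \<Rightarrow> 'a) \<Rightarrow> 'a \<Rightarrow> nat \<Rightarrow> 'w \<Rightarrow> 'a" where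
  "em_chain b h Z x 0 \<omega> = x"
| "em_chain b h Z x (Suc k) \<omega> =
     em_chain b h Z x k \<omega> + h *\<^sub>R b (em_chain b h Z x k \<omega>) + Z (Suc k) \<omega>"

definition em_kernel ::
    "'w measure \<Rightarrow> ('a::euclidean_space \<Rightarrow> 'a) \<Rightarrow> real \<Rightarrow> (nat \<Rightarrow> 'w \<Rightarrow> 'a) \<Rightarrow> 'a \<Rightarrow> 'a measure" where
  "em_kernel M b h Z x = distr M borel (em_chain b h Z x 1)"

definition invariant_distribution ::
    "('a::topological_space \<Rightarrow> 'a measure) \<Rightarrow> 'a measure \<Rightarrow> bool" where
  "invariant_distribution K \<pi> \<longleftrightarrow>
     prob_space \<pi> \<and> sets \<pi> = sets borel \<and>
     (\<forall>A\<in>sets borel. (\<integral>\<^sup>+x. emeasure (K x) A \<partial>\<pi>) = emeasure \<pi> A)"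

definition prob_density :: "('a::euclidean_space \<Rightarrow> real) \<Rightarrow> bool" where
  "prob_density q \<longleftrightarrow> (\<forall>x. 0 \<le> q x) \<and> has_bochner_integral lborel q 1"

text \<open>
  Weak convergence, as \<open>h\<close> decreases to 0, of the measures with densities \<open>p h\<close> to the Dirac
  measure at the origin; the library's \<open>weak_conv_m\<close> only covers sequences of measures on the line.
\<close>

definition weak_conv_delta0 :: "(real \<Rightarrow> 'a::euclidean_space \<Rightarrow> real) \<Rightarrow> bool" where
  "weak_conv_delta0 p \<longleftrightarrow>
     (\<forall>f::'a \<Rightarrow> real. continuous_on UNIV f \<and> bounded (range f) \<longrightarrow>
        ((\<lambda>h. LINT x|lborel. f x * p h x) \<longlongrightarrow> f 0) (at_right 0))"

definition scaled_tail :: "real \<Rightarrow> ('a::euclidean_space \<Rightarrow> real) \<Rightarrow> real \<Rightarrow> ereal" where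
  "scaled_tail \<alpha> q r = ereal (r powr \<alpha> * (LINT x:{x. norm x > r}|lborel. q x))"

end

theory Submission imports Defs begin

text \<open>
  Write \<open>F x = x + h *\<^sub>R b x\<close>, so that the chain is \<open>X (Suc n) = F (X n) + noise\<close> with \<open>F\<close> bounded on
  bounded sets.

  Part (a) needs one step of the chain. Some ball \<open>B\<close> about the origin has positive \<open>\<pi>\<close>-mass, and
  \<open>F\<close> maps it into a bounded set. From any point of \<open>B\<close> the next state leaves the ball of radius
  \<open>r\<close> as soon as the noise exceeds \<open>L * r\<close>, for a fixed \<open>L\<close>, and the lower tail hypothesis gives this
  a probability of order at least \<open>r powr - \<alpha>\<close>. By invariance the \<open>\<pi>\<close>-mass outside the ball of radius \<open>r\<close> is
  at least a multiple of \<open>r powr - \<alpha>\<close>; this is \<open>invariant_tail_lower_bound\<close>.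

  Part (b): superlinear growth of \<open>b\<close> gives \<open>norm (F y) \<ge> 3 * norm y\<close> for large \<open>y\<close>. Call a run
  starting at \<open>x\<close> good if its first step reaches norm at least \<open>R\<close> and the \<open>k\<close>-th noise after that
  step is at most \<open>R * 2 ^ k\<close>, for all \<open>k\<close>. From then on the norm of a good run at
  least doubles at each step, so the run escapes to infinity (\<open>norm_noisy_orbit_doubles\<close>). For a suitable \<open>R\<close> the probability of a
  good run is bounded below by some \<open>u > 0\<close> uniformly in \<open>x\<close>: the first step succeeds with
  probability bounded below, because the noise is unbounded (for \<open>x\<close> near the origin) or because \<open>F\<close>
  expands (for \<open>x\<close> far out); and since the noise has a first moment, Markov's inequality makes the
  failure probabilities of the later conditions sum to at most one half.

  A uniform lower bound suffices for almost sure escape. Let \<open>q\<close> be the supremum over the starting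
  points of the probability of not escaping. A run that does not escape must violate goodness at a
  first time, which is decided by the noise up to that time; the chain then starts afresh, and the
  conditional probability of not escaping is at most \<open>q\<close>. Summing over the time of the violation
  gives \<open>q \<le> (1 - u) * q\<close>, so \<open>q = 0\<close> (\<open>restart_event_null\<close>). Whether a run escapes is not affected by
  restarting at a finite time, which is what makes the restart possible.
\<close>

section \<open>Restarting an i.i.d. sequence\<close>

context sequence_space
begin

text \<open>
  The Markov property at the fixed time \<open>m\<close>, as an inequality: gluing the first \<open>m\<close> entries of one
  sequence to an independent copy does not change the law, so on an event \<open>D\<close> of the past a bound for
  the fresh copy can be integrated by Fubini.
\<close>

lemma emeasure_restart_le:
  assumes [measurable]: "N \<in> sets S" "D \<in> sets S"
    and past: "\<And>\<omega> \<omega>'. \<omega> \<in> space S \<Longrightarrow> \<omega>' \<in> space S \<Longrightarrow> comb_seq m \<omega> \<omega>' \<in> D \<longleftrightarrow> \<omega> \<in> D"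
    and fut: "\<And>\<omega>. \<omega> \<in> space S \<Longrightarrow> emeasure S {\<omega>' \<in> space S. comb_seq m \<omega> \<omega>' \<in> N} \<le> q"
  shows "emeasure S (D \<inter> N) \<le> q * emeasure S D"
proof -
  interpret SS: pair_prob_space S S ..
  let ?c = "\<lambda>(\<omega>, \<omega>'). comb_seq m \<omega> \<omega>'"
  let ?Q = "?c -` (D \<inter> N) \<inter> space (S \<Otimes>\<^sub>M S)"
  have c[measurable]: "?c \<in> measurable (S \<Otimes>\<^sub>M S) S"
    by (rule measurable_comb_seq)
  have Q[measurable]: "?Q \<in> sets (S \<Otimes>\<^sub>M S)"
    by (rule measurable_sets[OF c]) simp
  have "emeasure S (D \<inter> N) = emeasure (distr (S \<Otimes>\<^sub>M S) S ?c) (D \<inter> N)"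
    by (simp only: PiM_comb_seq)
  also have "\<dots> = emeasure (S \<Otimes>\<^sub>M S) ?Q"
    by (rule emeasure_distr[OF c]) simp
  also have "\<dots> = (\<integral>\<^sup>+\<omega>. emeasure S (Pair \<omega> -` ?Q) \<partial>S)"
    by (rule P.emeasure_pair_measure_alt[OF Q])
  also have "\<dots> \<le> (\<integral>\<^sup>+\<omega>. q * indicator D \<omega> \<partial>S)"
  proof (rule nn_integral_mono)
    fix \<omega> assume \<omega>: "\<omega> \<in> space S"
    have "Pair \<omega> -` ?Q = (if \<omega> \<in> D then {\<omega>' \<in> space S. comb_seq m \<omega> \<omega>' \<in> N} else {})"
      using past \<omega> by (auto simp: space_pair_measure)
    then show "emeasure S (Pair \<omega> -` ?Q) \<le> q * indicator D \<omega>"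
      using fut[OF \<omega>] by auto
  qed
  also have "\<dots> = q * emeasure S D"
    by (rule nn_integral_cmult_indicator) simp
  finally show ?thesis .
qed

lemma measure_PiM_initial_segment:
  assumes "\<And>k. G k \<in> sets M"
  shows "measure S {\<omega> \<in> space S. \<forall>k<n. \<omega> k \<in> G k} = (\<Prod>k<n. measure M (G k))"
proof -
  have "{\<omega> \<in> space S. \<forall>k<n. \<omega> k \<in> G k} = prod_emb UNIV (\<lambda>_. M) {..<n} (Pi\<^sub>E {..<n} G)"
    by (auto simp: prod_emb_def space_PiM Pi_iff)
  then show ?thesis
    using assms by (simp add: measure_PiM_emb)
qed

text \<open>
  The sets \<open>N x\<close> are bad events indexed by a state: after any finite past the bad event for \<open>x\<close>
  becomes the bad event for another state. A sequence in \<open>N x\<close> must leave one of the sets \<open>G x k\<close>;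
  splitting according to the first such \<open>k\<close> and restarting after it shows that the supremum \<open>q\<close> of
  the probabilities satisfies \<open>q \<le> (1 - u) * q\<close>.
\<close>

lemma restart_event_null:
  fixes N :: "'b \<Rightarrow> (nat \<Rightarrow> 'a) set" and G :: "'b \<Rightarrow> nat \<Rightarrow> 'a set"
  assumes N[measurable]: "\<And>x. N x \<in> sets S"
    and restart: "\<And>x m \<omega>. \<exists>y. \<forall>\<omega>'. comb_seq m \<omega> \<omega>' \<in> N x \<longleftrightarrow> \<omega>' \<in> N y"
    and G[measurable]: "\<And>x k. G x k \<in> sets M"
    and avoid: "\<And>x \<omega>. \<omega> \<in> N x \<Longrightarrow> \<exists>k. \<omega> k \<notin> G x k"
    and "0 < u" and u: "\<And>x n. u \<le> (\<Prod>k<n. measure M (G x k))"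
  shows "measure S (N x) = 0"
proof -
  define q where "q = (SUP x. measure S (N x))"
  have bdd: "bdd_above (range (\<lambda>x. measure S (N x)))"
    by (rule bdd_aboveI[of _ 1]) auto
  have q_ge: "measure S (N x) \<le> q" for x
    unfolding q_def by (rule cSUP_upper[OF _ bdd]) simp
  have q0: "0 \<le> q"
    using q_ge[of undefined] measure_nonneg[of S "N undefined"] by linarith
  have "measure S (N x) \<le> (1 - u) * q" for x
  proof -
    \<comment> \<open>No violation among the first \<open>n\<close> entries; \<open>A n - A (Suc n)\<close> is a first violation at \<open>n\<close>.\<close>
    define A where "A n = {\<omega> \<in> space S. \<forall>k<n. \<omega> k \<in> G x k}" for n
    have A[measurable]: "A n \<in> sets S" for n
      unfolding A_def by measurable
    have PA: "measure S (A n) = (\<Prod>k<n. measure M (G x k))" for n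
      unfolding A_def by (rule measure_PiM_initial_segment) simp
    have A_Suc: "A (Suc n) \<subseteq> A n" for n
      by (auto simp: A_def)
    have step: "measure S (A n \<inter> N x) - measure S (A (Suc n) \<inter> N x)
        \<le> q * (measure S (A n) - measure S (A (Suc n)))" for n
    proof -
      let ?D = "A n - A (Suc n)"
      have "emeasure S (?D \<inter> N x) \<le> ennreal q * emeasure S ?D"
      proof (rule emeasure_restart_le[where m = "Suc n"])
        fix \<omega> \<omega>' assume \<omega>: "\<omega> \<in> space S" "\<omega>' \<in> space S"
        then have "comb_seq (Suc n) \<omega> \<omega>' \<in> space S"
          by (auto simp: space_PiM PiE_iff split: split_comb_seq)
        with \<omega> show "comb_seq (Suc n) \<omega> \<omega>' \<in> ?D \<longleftrightarrow> \<omega> \<in> ?D"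
          by (simp add: A_def comb_seq_less)
      next
        fix \<omega> assume "\<omega> \<in> space S"
        obtain y where y: "\<And>\<omega>'. comb_seq (Suc n) \<omega> \<omega>' \<in> N x \<longleftrightarrow> \<omega>' \<in> N y"
          using restart by blast
        have "{\<omega>' \<in> space S. comb_seq (Suc n) \<omega> \<omega>' \<in> N x} = N y"
          using sets.sets_into_space[OF N[of y]] by (auto simp: y)
        then show "emeasure S {\<omega>' \<in> space S. comb_seq (Suc n) \<omega> \<omega>' \<in> N x} \<le> ennreal q"
          by (simp add: P.emeasure_eq_measure ennreal_leI[OF q_ge])
      qed measurable
      then have "measure S (?D \<inter> N x) \<le> q * measure S ?D"
        by (simp add: P.emeasure_eq_measure ennreal_mult[symmetric] q0)
      moreover have "?D \<inter> N x = (A n \<inter> N x) - (A (Suc n) \<inter> N x)"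
        by auto
      moreover have "measure S ((A n \<inter> N x) - (A (Suc n) \<inter> N x))
          = measure S (A n \<inter> N x) - measure S (A (Suc n) \<inter> N x)"
        using A_Suc[of n] by (intro P.finite_measure_Diff) auto
      moreover have "measure S ?D = measure S (A n) - measure S (A (Suc n))"
        using A_Suc[of n] by (intro P.finite_measure_Diff) auto
      ultimately show ?thesis by simp
    qed
    \<comment> \<open>Summing over the time of the first violation, written as a telescoping sum.\<close>
    have tel: "measure S (N x) - measure S (A n \<inter> N x) \<le> q * (1 - measure S (A n))" for n
    proof (induction n)
      case 0
      have "A 0 = space S" by (simp add: A_def)
      moreover have "space S \<inter> N x = N x"
        using sets.sets_into_space[OF N[of x]] by auto
      ultimately show ?case by (simp add: P.prob_space)
    next
      case (Suc n)
      then show ?case using step[of n] by (simp add: algebra_simps)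
    qed
    have "(\<lambda>n. measure S (A n \<inter> N x)) \<longlonglongrightarrow> measure S (\<Inter>n. A n \<inter> N x)"
      using A_Suc by (intro P.finite_Lim_measure_decseq decseq_SucI) auto
    moreover have "(\<Inter>n. A n \<inter> N x) = {}"
      using avoid[of _ x] by (fastforce simp: A_def)
    ultimately have lim: "(\<lambda>n. measure S (A n \<inter> N x)) \<longlonglongrightarrow> 0"
      by simp
    have "measure S (N x) - measure S (A n \<inter> N x) \<le> q * (1 - u)" for n
    proof -
      have "u \<le> measure S (A n)" unfolding PA by (rule u)
      then have "q * (1 - measure S (A n)) \<le> q * (1 - u)"
        using q0 by (intro mult_left_mono) auto
      with tel[of n] show ?thesis by linarith
    qed
    then have "measure S (N x) - 0 \<le> q * (1 - u)"
      by (intro LIMSEQ_le_const2[OF tendsto_diff[OF tendsto_const lim]]) auto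
    then show ?thesis by (simp add: mult.commute)
  qed
  then have "q \<le> (1 - u) * q"
    unfolding q_def[symmetric] by (subst q_def) (rule cSUP_least, auto)
  then have "u * q \<le> 0" by (simp add: algebra_simps)
  with \<open>0 < u\<close> have "q \<le> 0" by (simp add: mult_le_0_iff)
  then show ?thesis using q_ge[of x] measure_nonneg[of S "N x"] by linarith
qed

end

section \<open>Escape of an expanding map driven by i.i.d. noise\<close>

text \<open>
  The chain as a function of the noise sequence, with the noise numbered from 0, so that a run
  restarted at time \<open>m\<close> is driven by the sequence shifted by exactly \<open>m\<close>.
\<close>

primrec noisy_orbit :: "('a::euclidean_space \<Rightarrow> 'a) \<Rightarrow> 'a \<Rightarrow> (nat \<Rightarrow> 'a) \<Rightarrow> nat \<Rightarrow> 'a" where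
  "noisy_orbit F x \<omega> 0 = x"
| "noisy_orbit F x \<omega> (Suc n) = F (noisy_orbit F x \<omega> n) + \<omega> n"

lemma noisy_orbit_comb_seq_less:
  "n \<le> m \<Longrightarrow> noisy_orbit F x (comb_seq m \<omega> \<omega>') n = noisy_orbit F x \<omega> n"
  by (induction n) (auto simp: comb_seq_less)

lemma noisy_orbit_comb_seq_add:
  "noisy_orbit F x (comb_seq m \<omega> \<omega>') (n + m) = noisy_orbit F (noisy_orbit F x \<omega> m) \<omega>' n"
  by (induction n) (auto simp: noisy_orbit_comb_seq_less comb_seq_add)

lemma em_chain_eq_noisy_orbit:
  "em_chain b h Z x n \<omega> = noisy_orbit (\<lambda>x. x + h *\<^sub>R b x) x (\<lambda>k. Z (Suc k) \<omega>) n"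
  by (induction n) auto

lemma measurable_noisy_orbit:
  fixes F :: "'a::euclidean_space \<Rightarrow> 'a"
  assumes [measurable]: "F \<in> borel_measurable borel" and [measurable_cong]: "sets \<mu> = sets borel"
  shows "(\<lambda>\<omega>. noisy_orbit F x \<omega> n) \<in> borel_measurable (Pi\<^sub>M UNIV (\<lambda>_. \<mu>))"
proof (induction n)
  case (Suc n)
  note Suc[measurable]
  show ?case by simp
qed simp

text \<open>
  The factor 3 leaves room for the noise: once \<open>norm y \<ge> R * 2 ^ n\<close>, the next noise is at most
  \<open>norm y\<close>, and subtracting it from \<open>3 * norm y\<close> still leaves twice the norm.
\<close>

lemma norm_noisy_orbit_doubles:
  fixes F :: "'a::euclidean_space \<Rightarrow> 'a"
  assumes F: "\<And>y. R \<le> norm y \<Longrightarrow> 3 * norm y \<le> norm (F y)"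
    and "0 \<le> R" and start: "R \<le> norm (F x + \<omega> 0)"
    and noise: "\<And>k. norm (\<omega> (Suc k)) \<le> R * 2 ^ k"
  shows "R * 2 ^ n \<le> norm (noisy_orbit F x \<omega> (Suc n))"
proof (induction n)
  case 0
  show ?case using start by simp
next
  case (Suc n)
  let ?y = "noisy_orbit F x \<omega> (Suc n)"
  have "R * 1 \<le> R * 2 ^ n"
    using \<open>0 \<le> R\<close> by (intro mult_left_mono) auto
  then have "3 * norm ?y \<le> norm (F ?y)"
    using Suc by (intro F) simp
  moreover have "norm (F ?y) - norm (\<omega> (Suc n)) \<le> norm (F ?y + \<omega> (Suc n))"
    by (rule norm_diff_ineq)
  ultimately show ?case using Suc noise[of n] by simp
qed

lemma measurable_set_filterlim_norm:
  fixes X :: "nat \<Rightarrow> 'w \<Rightarrow> 'a::euclidean_space"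
  assumes [measurable]: "\<And>n. X n \<in> borel_measurable M"
  shows "{\<omega> \<in> space M. filterlim (\<lambda>n. norm (X n \<omega>)) at_top sequentially} \<in> sets M"
proof -
  \<comment> \<open>Integer thresholds suffice, so the event is a countable combination of measurable ones.\<close>
  have "filterlim (\<lambda>n. norm (X n \<omega>)) at_top sequentially \<longleftrightarrow>
      (\<forall>K::nat. \<exists>n0. \<forall>n\<ge>n0. real K \<le> norm (X n \<omega>))" for \<omega>
    unfolding filterlim_at_top eventually_sequentially
    by (meson order_trans real_arch_simple)
  then show ?thesis by simp
qed

text \<open>
  The good conditions \<open>G y k\<close> on the \<open>k\<close>-th noise have a product probability bounded below uniformly
  in the starting point \<open>y\<close> and together force the norm to double forever; so
  \<open>restart_event_null\<close> applies to the event of not escaping.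
\<close>

theorem noisy_orbit_transient:
  fixes F :: "'a::euclidean_space \<Rightarrow> 'a"
  assumes \<mu>: "prob_space \<mu>" and sets_\<mu>[measurable_cong]: "sets \<mu> = sets borel"
    and F[measurable]: "F \<in> borel_measurable borel"
    and bounded_F: "\<And>R. bounded (F ` cball 0 R)"
    and expand: "eventually (\<lambda>y. 3 * norm y \<le> norm (F y)) at_infinity"
    and int: "integrable \<mu> norm"
    and unbounded_noise: "\<And>s. 0 < measure \<mu> {z. s < norm z}"
  shows "measure (Pi\<^sub>M UNIV (\<lambda>_. \<mu>)) {\<omega> \<in> space (Pi\<^sub>M UNIV (\<lambda>_. \<mu>)).
      filterlim (\<lambda>n. norm (noisy_orbit F x \<omega> n)) at_top sequentially} = 1"
proof -
  interpret \<mu>: prob_space \<mu> by fact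
  interpret sequence_space \<mu> ..
  have space_\<mu>[simp]: "space \<mu> = UNIV"
    using sets_eq_imp_space_eq[OF sets_\<mu>] by simp
  define m where "m = integral\<^sup>L \<mu> norm"
  have m0: "0 \<le> m" unfolding m_def by simp
  obtain R0 where R0: "\<And>y. R0 \<le> norm y \<Longrightarrow> 3 * norm y \<le> norm (F y)"
    using expand unfolding eventually_at_infinity by blast
  \<comment> \<open>By Markov's inequality \<open>R \<ge> 4 * m\<close> bounds the probability that the noise exceeds \<open>R * 2 ^ k\<close>
    by \<open>1/4 * (1/2) ^ k\<close>; these bounds sum to \<open>1/2\<close>.\<close>
  define R where "R = max 1 (max R0 (4 * m))"
  have R: "1 \<le> R" "4 * m \<le> R" and FR: "\<And>y. R \<le> norm y \<Longrightarrow> 3 * norm y \<le> norm (F y)"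
    using R0 by (auto simp: R_def)
  have markov: "measure \<mu> {z. c < norm z} \<le> m / c" if "0 < c" for c
  proof -
    have "measure \<mu> {z. c < norm z} \<le> measure \<mu> {z \<in> space \<mu>. c \<le> norm z}"
      by (intro \<mu>.finite_measure_mono) auto
    also have "\<dots> \<le> m / c"
      unfolding m_def using that int
      by (intro integral_Markov_inequality_measure[where A = "space \<mu>"]) auto
    finally show ?thesis .
  qed
  have small: "1 - m / c \<le> measure \<mu> {z. norm z \<le> c}" if "0 < c" for c
  proof -
    have "{z. norm z \<le> c} = space \<mu> - {z. c < norm z}" by auto
    then have "measure \<mu> {z. norm z \<le> c} = 1 - measure \<mu> {z. c < norm z}"
      by (simp only:) (rule \<mu>.prob_compl, measurable)
    with markov[OF that] show ?thesis by simp
  qed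
  obtain B where B: "\<And>y. norm y \<le> R \<Longrightarrow> norm (F y) \<le> B"
    using bounded_F[of R] by (force simp: bounded_iff)
  define G where "G y k = (case k of 0 \<Rightarrow> {z. R \<le> norm (F y + z)} | Suc j \<Rightarrow> {z. norm z \<le> R * 2 ^ j})"
    for y :: 'a and k
  have G[measurable]: "G y k \<in> sets \<mu>" for y k
    unfolding G_def by (cases k) auto
  define \<delta> where "\<delta> = min (1/2) (measure \<mu> {z. R + B < norm z})"
  have \<delta>: "0 < \<delta>" using unbounded_noise by (simp add: \<delta>_def)
  have G0: "\<delta> \<le> measure \<mu> (G y 0)" for y
  \<comment> \<open>From the ball of radius \<open>R\<close> a large noise throws the orbit out; outside it the expansion
    keeps the orbit out unless the noise exceeds \<open>R\<close>.\<close>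
  proof (cases "norm y \<le> R")
    case True
    have "R \<le> norm (F y + z)" if "R + B < norm z" for z
      using that B[OF True] norm_diff_ineq[of z "F y"] by (simp add: add.commute)
    then have "measure \<mu> {z. R + B < norm z} \<le> measure \<mu> (G y 0)"
      using G[of y 0] by (intro \<mu>.finite_measure_mono) (auto simp: G_def)
    then show ?thesis by (simp add: \<delta>_def)
  next
    case False
    have "R \<le> norm (F y + z)" if "norm z \<le> R" for z
      using that FR[of y] False norm_diff_ineq[of "F y" z] R by simp
    then have "measure \<mu> {z. norm z \<le> R} \<le> measure \<mu> (G y 0)"
      using G[of y 0] by (intro \<mu>.finite_measure_mono) (auto simp: G_def)
    moreover have "m / R \<le> 1/2" using R m0 by (simp add: field_simps)
    moreover have "\<delta> \<le> 1/2" by (simp add: \<delta>_def)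
    ultimately show ?thesis using small[of R] R by linarith
  qed
  have tailprod: "1/2 \<le> (\<Prod>k<n. measure \<mu> (G y (Suc k)))" for y n
  proof -
    define f where "f k = (1/4) * (1/2::real) ^ k" for k
    have f: "f k \<in> {0..1}" for k
      using power_le_one[of "1/2::real" k] unfolding f_def by auto
    have "(\<Sum>k<n. f k) = (1 - (1/2)^n) / 2"
      unfolding f_def sum_distrib_left[symmetric] by (simp add: sum_gp_strict)
    also have "\<dots> \<le> 1/2" by simp
    finally have "1/2 \<le> 1 - (\<Sum>k<n. f k)" by simp
    also have "\<dots> \<le> (\<Prod>k<n. 1 - f k)"
      using f by (intro Weierstrass_prod_ineq)
    also have "\<dots> \<le> (\<Prod>k<n. measure \<mu> (G y (Suc k)))"
    proof (intro prod_mono conjI)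
      fix k
      show "0 \<le> 1 - f k" using f[of k] by simp
      have "m / (R * 2 ^ k) \<le> f k"
        using R m0 by (simp add: f_def field_simps)
      then show "1 - f k \<le> measure \<mu> (G y (Suc k))"
        using small[of "R * 2 ^ k"] R by (simp add: G_def)
    qed
    finally show ?thesis .
  qed
  have u: "\<delta> / 2 \<le> (\<Prod>k<n. measure \<mu> (G y k))" for y n
  proof (cases n)
    case 0
    then show ?thesis by (simp add: \<delta>_def)
  next
    case (Suc j)
    have "\<delta> * (1/2) \<le> measure \<mu> (G y 0) * (\<Prod>k<j. measure \<mu> (G y (Suc k)))"
      using \<delta> by (intro mult_mono G0 tailprod) auto
    then show ?thesis unfolding Suc prod.lessThan_Suc_shift by simp
  qed
  define esc where "esc y \<omega> \<longleftrightarrow> filterlim (\<lambda>n. norm (noisy_orbit F y \<omega> n)) at_top sequentially" for y \<omega>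
  define N where "N y = {\<omega>. \<not> esc y \<omega>}" for y
  have space_S[simp]: "space S = UNIV" by (simp add: space_PiM)
  have E: "{\<omega>. esc y \<omega>} \<in> sets S" for y
  proof -
    have "{\<omega> \<in> space S. esc y \<omega>} \<in> sets S"
      unfolding esc_def by (intro measurable_set_filterlim_norm measurable_noisy_orbit F sets_\<mu>)
    then show ?thesis by simp
  qed
  have N_compl: "N y = space S - {\<omega>. esc y \<omega>}" for y by (auto simp: N_def)
  have null: "measure S (N x) = 0"
  proof (rule restart_event_null[where G = G and u = "\<delta> / 2"])
    show "N y \<in> sets S" for y unfolding N_compl by (rule sets.compl_sets[OF E])
    show "\<exists>y'. \<forall>\<omega>'. comb_seq m \<omega> \<omega>' \<in> N y \<longleftrightarrow> \<omega>' \<in> N y'" for y m \<omega>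
    proof (intro exI allI)
      fix \<omega>'
      have "esc y (comb_seq m \<omega> \<omega>') \<longleftrightarrow> filterlim
          (\<lambda>n. norm (noisy_orbit F y (comb_seq m \<omega> \<omega>') (n + m))) at_top sequentially"
        unfolding esc_def filterlim_iff
        by (simp only: eventually_sequentially_seg[of
            "\<lambda>n. P (norm (noisy_orbit F y (comb_seq m \<omega> \<omega>') n))" m for P])
      then show "comb_seq m \<omega> \<omega>' \<in> N y \<longleftrightarrow> \<omega>' \<in> N (noisy_orbit F y \<omega> m)"
        by (simp add: N_def esc_def noisy_orbit_comb_seq_add)
    qed
    show "\<exists>k. \<omega> k \<notin> G y k" if "\<omega> \<in> N y" for y \<omega>
    proof (rule ccontr)
      assume "\<not> ?thesis"
      then have all: "\<omega> k \<in> G y k" for k by simp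
      have "R * 2 ^ n \<le> norm (noisy_orbit F y \<omega> (Suc n))" for n
      proof (rule norm_noisy_orbit_doubles[OF FR])
        show "R \<le> norm (F y + \<omega> 0)" using all[of 0] by (simp add: G_def)
        show "norm (\<omega> (Suc k)) \<le> R * 2 ^ k" for k using all[of "Suc k"] by (simp add: G_def)
      qed (use R in auto)
      moreover have "real n \<le> R * 2 ^ n" for n
      proof -
        have "real n \<le> 1 * 2 ^ n" using of_nat_less_two_power[of n, where 'a = real] by simp
        also have "\<dots> \<le> R * 2 ^ n" using R by (intro mult_right_mono) auto
        finally show ?thesis .
      qed
      ultimately have "real n \<le> norm (noisy_orbit F y \<omega> (Suc n))" for n
        by (meson order_trans)
      then have "filterlim (\<lambda>n. norm (noisy_orbit F y \<omega> (Suc n))) at_top sequentially"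
        by (intro filterlim_at_top_mono[OF filterlim_real_sequentially] always_eventually) simp
      then have "esc y \<omega>"
        unfolding esc_def by (subst (asm) filterlim_sequentially_Suc)
      with that show False by (simp add: N_def)
    qed
  qed (use \<delta> u G in auto)
  have "measure S (space S - {\<omega>. esc x \<omega>}) = 0"
    using null by (simp only: N_compl)
  then show ?thesis
    using P.prob_compl[OF E[of x]] by (simp add: esc_def)
qed

text \<open>
  An i.i.d. sequence has a product law, and dropping its first entry keeps that law; so escape on
  the sequence space is escape on any probability space that carries the noise.
\<close>

theorem iid_driven_orbit_transient:
  fixes F :: "'a::euclidean_space \<Rightarrow> 'a" and Z :: "nat \<Rightarrow> 'w \<Rightarrow> 'a"
  assumes "prob_space M"
    and indep: "prob_space.indep_vars M (\<lambda>_. borel) Z UNIV"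
    and law: "\<And>k. distr M borel (Z k) = \<mu>"
    and F: "F \<in> borel_measurable borel"
    and "\<And>R. bounded (F ` cball 0 R)"
    and "eventually (\<lambda>y. 3 * norm y \<le> norm (F y)) at_infinity"
    and "integrable \<mu> norm"
    and "\<And>s. 0 < measure \<mu> {z. s < norm z}"
  shows "measure M {\<omega> \<in> space M.
      filterlim (\<lambda>n. norm (noisy_orbit F x (\<lambda>k. Z (Suc k) \<omega>) n)) at_top sequentially} = 1"
proof -
  interpret prob_space M by fact
  have Z[measurable]: "Z k \<in> borel_measurable M" for k
    using indep by (auto simp: indep_vars_def)
  have sets_\<mu>: "sets \<mu> = sets borel" using law[of 0] by auto
  have \<mu>: "prob_space \<mu>" using prob_space_distr[OF Z[of 0]] law by simp
  let ?S = "Pi\<^sub>M UNIV (\<lambda>_::nat. \<mu>)"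
  have sets_S: "sets ?S = sets (Pi\<^sub>M UNIV (\<lambda>_::nat. borel :: 'a measure))"
    by (rule sets_PiM_cong) (auto simp: sets_\<mu>)
  have "distr M (Pi\<^sub>M UNIV (\<lambda>_. borel)) (\<lambda>\<omega> k. Z k \<omega>) = ?S"
    using indep_vars_iff_distr_eq_PiM[where I = UNIV and M' = "\<lambda>_. borel" and X = Z] indep
    by (simp add: law restrict_UNIV)
  then have full: "distr M ?S (\<lambda>\<omega> k. Z k \<omega>) = ?S"
    by (simp cong: distr_cong add: sets_S)
  have spS: "space ?S = UNIV"
    by (simp add: space_PiM sets_eq_imp_space_eq[OF sets_\<mu>])
  have Zseq: "(\<lambda>\<omega> k. Z (f k) \<omega>) \<in> measurable M ?S" for f :: "nat \<Rightarrow> nat"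
    by (intro measurable_PiM_single')
      (auto simp: measurable_cong_sets[OF refl sets_\<mu>] spS sets_eq_imp_space_eq[OF sets_\<mu>])
  have shift: "(\<lambda>\<omega> k. \<omega> (Suc k)) \<in> measurable ?S ?S"
    by (intro measurable_PiM_single' measurable_component_singleton)
      (auto simp: spS sets_eq_imp_space_eq[OF sets_\<mu>])
  have "distr ?S ?S (\<lambda>\<omega> k. \<omega> (Suc k)) = ?S"
    using distr_PiM_reindex[of UNIV "\<lambda>_. \<mu>" Suc UNIV] \<mu> by (simp add: restrict_UNIV)
  then have "?S = distr (distr M ?S (\<lambda>\<omega> k. Z k \<omega>)) ?S (\<lambda>\<omega> k. \<omega> (Suc k))"
    by (simp add: full)
  also have "\<dots> = distr M ?S (\<lambda>\<omega> k. Z (Suc k) \<omega>)"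
    by (subst distr_distr) (simp_all add: Zseq shift o_def)
  finally have S: "distr M ?S (\<lambda>\<omega> k. Z (Suc k) \<omega>) = ?S" ..
  let ?E = "{\<omega> \<in> space ?S. filterlim (\<lambda>n. norm (noisy_orbit F x \<omega> n)) at_top sequentially}"
  have "measure (distr M ?S (\<lambda>\<omega> k. Z (Suc k) \<omega>)) ?E = 1"
    unfolding S using assms by (intro noisy_orbit_transient \<mu> sets_\<mu>)
  moreover have "?E \<in> sets ?S"
    by (intro measurable_set_filterlim_norm measurable_noisy_orbit F sets_\<mu>)
  ultimately show ?thesis
    by (simp add: measure_distr[OF Zseq] spS vimage_def Int_def conj_commute)
qed

section \<open>Tails of invariant distributions\<close>

text \<open>
  One large jump out of a ball of positive \<open>\<pi>\<close>-mass: from every point of the ball, a noise above a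
  fixed multiple of \<open>r\<close> carries the chain beyond distance \<open>r\<close>, so this ball alone contributes enough
  to the invariance integral.
\<close>

theorem invariant_tail_lower_bound:
  fixes F :: "'a::euclidean_space \<Rightarrow> 'a"
  assumes inv: "invariant_distribution K \<pi>"
    and K: "\<And>x. K x = distr \<mu> borel (\<lambda>z. F x + z)"
    and \<mu>: "prob_space \<mu>" and sets_\<mu>[measurable_cong]: "sets \<mu> = sets borel"
    and bounded_F: "\<And>R. bounded (F ` cball 0 R)"
    and "0 < c" and tail: "eventually (\<lambda>s. c * s powr - \<alpha> \<le> measure \<mu> {z. s < norm z}) at_top"
  shows "\<exists>K>0. \<forall>r\<ge>1. K * r powr - \<alpha> \<le> measure \<pi> {y. r < norm y}"
proof -
  interpret \<mu>: prob_space \<mu> by fact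
  interpret \<pi>: prob_space \<pi> using inv by (simp add: invariant_distribution_def)
  have sets_\<pi>[measurable_cong]: "sets \<pi> = sets borel"
    using inv by (simp add: invariant_distribution_def)
  have space_\<mu>[simp]: "space \<mu> = UNIV" and space_\<pi>[simp]: "space \<pi> = UNIV"
    using sets_eq_imp_space_eq[OF sets_\<mu>] sets_eq_imp_space_eq[OF sets_\<pi>] by simp_all
  obtain n :: nat where n: "0 < measure \<pi> (cball 0 (real n))"
  proof -
    have "(\<lambda>n. measure \<pi> (cball 0 (real n))) \<longlonglongrightarrow> measure \<pi> (\<Union>n. cball 0 (real n))"
      by (rule \<pi>.finite_Lim_measure_incseq) (auto simp: incseq_def)
    also have "(\<Union>n. cball 0 (real n)) = (UNIV :: 'a set)"
      by (auto intro: real_arch_simple)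
    finally have "(\<lambda>n. measure \<pi> (cball 0 (real n))) \<longlonglongrightarrow> 1"
      using \<pi>.prob_space by simp
    then have "eventually (\<lambda>n. 0 < measure \<pi> (cball 0 (real n))) sequentially"
      by (rule order_tendstoD) simp
    then show ?thesis using that by (auto simp: eventually_sequentially)
  qed
  obtain B where B: "\<And>y. y \<in> cball 0 (real n) \<Longrightarrow> norm (F y) \<le> B"
    using bounded_F[of n] by (force simp: bounded_iff)
  obtain s0 where s0: "\<And>s. s0 \<le> s \<Longrightarrow> c * s powr - \<alpha> \<le> measure \<mu> {z. s < norm z}"
    using tail by (auto simp: eventually_at_top_linorder)
  \<comment> \<open>Chosen so that \<open>L * r\<close> is at least \<open>r + B\<close> and at least \<open>s0\<close> for every \<open>r \<ge> 1\<close>.\<close>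
  define L where "L = max 1 (1 + max B s0)"
  define K0 where "K0 = measure \<pi> (cball 0 (real n)) * (c * L powr - \<alpha>)"
  have "K0 * r powr - \<alpha> \<le> measure \<pi> {y. r < norm y}" if r: "1 \<le> r" for r
  proof -
    have L: "1 \<le> L" "B + 1 \<le> L" "s0 + 1 \<le> L" by (auto simp: L_def)
    have Lr: "r + (L - 1) \<le> L * r"
    proof -
      have "0 \<le> (L - 1) * (r - 1)" using L r by simp
      then show ?thesis by (simp add: algebra_simps)
    qed
    let ?t = "c * (L * r) powr - \<alpha>"
    have jump: "ennreal ?t \<le> emeasure (K x) {y. r < norm y}" if x: "x \<in> cball 0 (real n)" for x
    proof -
      have "s0 \<le> L * r" using Lr L r by linarith
      then have "?t \<le> measure \<mu> {z. L * r < norm z}" by (rule s0)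
      also have "\<dots> \<le> measure \<mu> {z. r < norm (F x + z)}"
      proof (rule \<mu>.finite_measure_mono)
        show "{z. L * r < norm z} \<subseteq> {z. r < norm (F x + z)}"
        proof safe
          fix z :: 'a assume "L * r < norm z"
          then show "r < norm (F x + z)"
            using Lr L B[OF x] norm_diff_ineq[of z "F x"] by (simp add: add.commute)
        qed
      qed measurable
      finally show ?thesis
        by (simp add: K emeasure_distr \<mu>.emeasure_eq_measure vimage_def)
    qed
    have "ennreal (K0 * r powr - \<alpha>) = ennreal ?t * emeasure \<pi> (cball 0 (real n))"
      using L r \<open>0 < c\<close>
      by (simp add: K0_def powr_mult \<pi>.emeasure_eq_measure ennreal_mult[symmetric] mult_ac)
    also have "\<dots> = (\<integral>\<^sup>+x. ennreal ?t * indicator (cball 0 (real n)) x \<partial>\<pi>)"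
      by (rule nn_integral_cmult_indicator[symmetric]) simp
    also have "\<dots> \<le> (\<integral>\<^sup>+x. emeasure (K x) {y. r < norm y} \<partial>\<pi>)"
      by (rule nn_integral_mono) (auto split: split_indicator intro: jump)
    also have "\<dots> = emeasure \<pi> {y. r < norm y}"
      using inv by (auto simp: invariant_distribution_def)
    finally show ?thesis
      by (simp add: \<pi>.emeasure_eq_measure)
  qed
  moreover have "0 < K0"
    using n \<open>0 < c\<close> by (simp add: K0_def L_def)
  ultimately show ?thesis by blast
qed

section \<open>The hypotheses on noise and drift\<close>

lemma noise_tail_eventually_ge:
  assumes "0 < Liminf at_top (scaled_tail \<alpha> q)"
  obtains c where "0 < c"
    "eventually (\<lambda>s. c * s powr - \<alpha> \<le> (LINT z:{z. s < norm z}|lborel. q z)) at_top"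
proof -
  obtain c where c: "0 < ereal c" "ereal c < Liminf at_top (scaled_tail \<alpha> q)"
    using ereal_dense2[OF assms] by (auto simp: zero_ereal_def)
  have "eventually (\<lambda>s. c * s powr - \<alpha> \<le> (LINT z:{z. s < norm z}|lborel. q z)) at_top"
    using less_LiminfD[OF c(2)] eventually_gt_at_top[of 0]
  proof eventually_elim
    case (elim s)
    then show ?case
      by (simp add: scaled_tail_def powr_minus field_simps)
  qed
  with c(1) that show ?thesis by simp
qed

text \<open>
  If \<open>norm (b x) > 4 / h * norm x\<close>, the drift step has length above \<open>4 * norm x\<close>, and the starting point
  takes away at most \<open>norm x\<close>, whatever the direction of \<open>b x\<close>.
\<close>

lemma superlinear_drift_expands:
  fixes b :: "'a::euclidean_space \<Rightarrow> 'a"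
  assumes "0 < h" and sup: "Liminf at_infinity (\<lambda>x. ereal (norm (b x) / norm x)) = \<infinity>"
  shows "eventually (\<lambda>x. 3 * norm x \<le> norm (x + h *\<^sub>R b x)) at_infinity"
proof -
  have "eventually (\<lambda>x. ereal (4 / h) < ereal (norm (b x) / norm x)) at_infinity"
    by (rule less_LiminfD) (simp add: sup)
  moreover have "eventually (\<lambda>x::'a. 0 < norm x) at_infinity"
    unfolding eventually_at_infinity by (rule exI[of _ 1]) auto
  ultimately show ?thesis
  proof eventually_elim
    case (elim x)
    then have "4 * norm x < norm (h *\<^sub>R b x)"
      using \<open>0 < h\<close> by (simp add: field_simps)
    then show ?case
      using norm_diff_ineq[of "h *\<^sub>R b x" x] by (simp add: add.commute)
  qed
qed

section \<open>The Markov chain with heavy-tailed noise\<close>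

theorem theorem3p19:
  fixes b :: "real ^ 'd \<Rightarrow> real ^ 'd"
    and h \<alpha> :: real
    and p :: "real \<Rightarrow> real ^ 'd \<Rightarrow> real"
    and M :: "'w measure"
    and Z :: "nat \<Rightarrow> 'w \<Rightarrow> real ^ 'd"
  assumes "continuous_on UNIV b"
    and "h > 0"
    and "1 < \<alpha>" and "\<alpha> < 2"
    and "\<And>s. s > 0 \<Longrightarrow> prob_density (p s)"
    and "weak_conv_delta0 p"
    and "prob_space M"
    and "prob_space.indep_vars M (\<lambda>_. borel) Z UNIV"
    and "\<And>k. distributed M lborel (Z k) (\<lambda>x. ennreal (p h x))"
    and "\<And>k. has_bochner_integral M (Z k) 0"
    and "0 < Liminf at_top (scaled_tail \<alpha> (p h))"
    and "Limsup at_top (scaled_tail \<alpha> (p h)) < \<infinity>"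
  shows
    "(\<forall>C>0. (\<forall>x. norm (b x) \<le> C * (norm x + 1)) \<longrightarrow> h < 1 / (2 * C) \<longrightarrow>
        (\<forall>\<pi>. invariant_distribution (em_kernel M b h Z) \<pi> \<longrightarrow>
          (\<forall>\<epsilon>>0. \<exists>K>0. \<forall>r\<ge>1. measure \<pi> {y. norm y > r} \<ge> K * r powr (- \<alpha> - \<epsilon>)))) \<and>
     (Liminf at_infinity (\<lambda>x. ereal (norm (b x) / norm x)) = \<infinity> \<longrightarrow>
        (\<forall>x. measure M {\<omega> \<in> space M.
                filterlim (\<lambda>n. norm (em_chain b h Z x n \<omega>)) at_top sequentially} = 1))"
proof -
  interpret M: prob_space M by fact
  define \<mu> where "\<mu> = density lborel (\<lambda>x. ennreal (p h x))"
  define F where "F = (\<lambda>x. x + h *\<^sub>R b x)"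
  have law: "distr M borel (Z k) = \<mu>" for k
  proof -
    have "distr M borel (Z k) = distr M lborel (Z k)" by (rule distr_cong) auto
    also have "\<dots> = \<mu>" using assms(9)[of k] by (simp add: distributed_def \<mu>_def)
    finally show ?thesis .
  qed
  have Z[measurable]: "Z k \<in> borel_measurable M" for k
    using assms(9)[of k] by (simp add: distributed_def)
  have \<mu>: "prob_space \<mu>" using M.prob_space_distr[OF Z[of 0]] law by simp
  interpret \<mu>: prob_space \<mu> by fact
  have sets_\<mu>: "sets \<mu> = sets borel" by (simp add: \<mu>_def)
  have q: "\<And>x. 0 \<le> p h x" "integrable lborel (p h)"
    using assms(2,5) by (auto simp: prob_density_def has_bochner_integral_iff)
  have tail_eq: "measure \<mu> {z. s < norm z} = (LINT z:{z. s < norm z}|lborel. p h z)" for s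
  proof -
    let ?A = "{z :: real ^ 'd. s < norm z}"
    have "emeasure \<mu> ?A = (\<integral>\<^sup>+z. ennreal (p h z) * indicator ?A z \<partial>lborel)"
      unfolding \<mu>_def using q(2) by (intro emeasure_density) auto
    also have "\<dots> = (\<integral>\<^sup>+z. ennreal (indicator ?A z *\<^sub>R p h z) \<partial>lborel)"
      by (intro nn_integral_cong) (auto split: split_indicator)
    also have "\<dots> = ennreal (LINT z:?A|lborel. p h z)"
      unfolding set_lebesgue_integral_def using q
      by (intro nn_integral_eq_integral integrable_mult_indicator) (auto simp: indicator_def)
    finally show ?thesis
      using q(1) by (simp add: measure_def set_lebesgue_integral_def)
  qed
  obtain c where c: "0 < c"
    and tail: "eventually (\<lambda>s. c * s powr - \<alpha> \<le> measure \<mu> {z. s < norm z}) at_top"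
    using noise_tail_eventually_ge[OF assms(11)] by (auto simp: tail_eq)
  have unbounded: "0 < measure \<mu> {z. s < norm z}" for s
  proof -
    have "eventually (\<lambda>t. max 0 s < t \<and> c * t powr - \<alpha> \<le> measure \<mu> {z. t < norm z}) at_top"
      using tail eventually_gt_at_top[of "max 0 s"] by eventually_elim simp
    then obtain t where t: "max 0 s < t" "c * t powr - \<alpha> \<le> measure \<mu> {z. t < norm z}"
      by (auto simp: eventually_at_top_linorder)
    have "0 < c * t powr - \<alpha>" using c t(1) by simp
    also note t(2)
    also have "measure \<mu> {z. t < norm z} \<le> measure \<mu> {z. s < norm z}"
      using t(1) by (intro \<mu>.finite_measure_mono) (auto simp: sets_\<mu>)
    finally show ?thesis .
  qed
  have cont_F: "continuous_on A F" for A
    unfolding F_def using continuous_on_subset[OF assms(1)] by (intro continuous_intros) auto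
  have F_meas: "F \<in> borel_measurable borel"
    by (rule borel_measurable_continuous_onI[OF cont_F])
  have F_bounded: "bounded (F ` cball 0 R)" for R
    by (intro compact_imp_bounded compact_continuous_image cont_F compact_cball)
  have int_norm: "integrable \<mu> norm"
  proof -
    have "integrable M (\<lambda>\<omega>. norm (Z 0 \<omega>))"
      using assms(10)[of 0] by (auto simp: has_bochner_integral_iff)
    then show ?thesis
      unfolding law[of 0, symmetric] by (subst integrable_distr_eq) auto
  qed
  have K: "em_kernel M b h Z x = distr \<mu> borel (\<lambda>z. F x + z)" for x
  proof -
    have "em_kernel M b h Z x = distr M borel (\<lambda>\<omega>. F x + Z 1 \<omega>)"
      by (simp add: em_kernel_def F_def cong: distr_cong)
    also have "\<dots> = distr (distr M borel (Z 1)) borel (\<lambda>z. F x + z)"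
      by (subst distr_distr) (auto simp: o_def)
    finally show ?thesis by (simp only: law)
  qed
  show ?thesis
  proof (intro conjI allI impI)
    fix C \<epsilon> :: real and \<pi>
    assume "invariant_distribution (em_kernel M b h Z) \<pi>" and "0 < \<epsilon>"
    then have "\<exists>K>0. \<forall>r\<ge>1. K * r powr - \<alpha> \<le> measure \<pi> {y. r < norm y}"
      by (intro invariant_tail_lower_bound[OF _ K \<mu> sets_\<mu> F_bounded c tail])
    then obtain K0 where K0: "0 < K0" "\<And>r. 1 \<le> r \<Longrightarrow> K0 * r powr - \<alpha> \<le> measure \<pi> {y. r < norm y}"
      by blast
    have "K0 * r powr (- \<alpha> - \<epsilon>) \<le> measure \<pi> {y. r < norm y}" if "1 \<le> r" for r
    proof -
      have "K0 * r powr (- \<alpha> - \<epsilon>) \<le> K0 * r powr - \<alpha>"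
        using that K0(1) \<open>0 < \<epsilon>\<close> by (intro mult_left_mono powr_mono) auto
      with K0(2)[OF that] show ?thesis by linarith
    qed
    with K0(1) show "\<exists>K>0. \<forall>r\<ge>1. measure \<pi> {y. norm y > r} \<ge> K * r powr (- \<alpha> - \<epsilon>)"
      by blast
  next
    fix x
    assume "Liminf at_infinity (\<lambda>x. ereal (norm (b x) / norm x)) = \<infinity>"
    then have "eventually (\<lambda>y. 3 * norm y \<le> norm (F y)) at_infinity"
      unfolding F_def using assms(2) by (rule superlinear_drift_expands[rotated])
    then show "measure M {\<omega> \<in> space M.
        filterlim (\<lambda>n. norm (em_chain b h Z x n \<omega>)) at_top sequentially} = 1"
      unfolding em_chain_eq_noisy_orbit F_def[symmetric]
      by (intro iid_driven_orbit_transient[where \<mu> = \<mu>] assms(7,8) law F_meas F_bounded int_norm unbounded)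
  qed
qed

end
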